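(* Let $X=X_n$ be the number of correct guesses under the optimal strategy for an $n$-card deck riffle-shuffled once, and let $\mu=E[X_n]$. As $n\to\infty$ through even integers, $$E[(X-\mu)^2]=\left(\frac34-\frac2\pi\right)n-\frac34+\frac3\pi-\sqrt{\frac{2}{\pi n}}+\frac{11}{12\pi n}+O(n^{-3/2}),$$ $$E[(X-\mu)^3]=\sqrt{\frac2\pi}\left(\left(\frac4\pi-\frac54\right)n^{3/2}+\left(\frac{43}{16}-\frac9\pi\right)n^{1/2}-\frac{3\sqrt{2\pi}}{4}+3\sqrt{\frac2\pi}-\left(\frac{241}{128}-\frac{5}{8\pi}\right)\frac{1}{\sqrt n}+O(n^{-1})\right).$$
   Context: Riffle shuffle (Gilbert–Shannon–Reeds model): a deck of $n$ cards labeled $1,\dots,n$ from top to bottom is cut so that the top pile consists of the top $t$ cards with probability $\binom{n}{t}/2^n$ ($0\le t\le n$); then the two piles are interleaved into a single deck, keeping the relative order inside each pile, all $\binom nt$ interleavings being equally likely. Thus each pair (cut position, interleaving) has probability $2^{-n}$. Game with complete feedback: after one riffle shuffle the player guesses the cards one at a time from the top; after each guess the identity of that card is revealed. The goal is to maximize the expected number of correct guesses. Optimal strategy for one shuffle: as long as the revealed cards are $1,2,\dots,j$ (with $j\ge 0$), guess $j+1$. At the first time the revealed card is some $m\neq j+1$, the remaining deck is known to be an interleaving of the two increasing sequences $\{j+1,\dots,m-1\}$ and $\{m+1,\dots,n\}$; from then on, always guess the first (smallest) remaining card of the longer of the two remaining sequences (in case of equal lengths, the one giving the lower card number). $X_n$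 is the total number of correct guesses under this strategy for a deck of $n$ cards shuffled once. *)

theory Defs
  imports "HOL-Probability.Probability"
begin

text \<open>
  A deck is the list of its cards from top to bottom. The cut position \<open>t\<close> and the
  interleaving are drawn separately, so decks that arise from several cuts (only the
  sorted deck does) accumulate the probability of each of them.
\<close>

definition riffle :: "nat \<Rightarrow> nat list pmf" where
  "riffle n =
     bind_pmf (binomial_pmf n (1/2))
       (\<lambda>t. pmf_of_set (shuffles [1..<t+1] [t+1..<n+1]))"

text \<open>
  A strategy under complete feedback maps the list of the cards revealed so far (in order
  of revelation) to the next guess.
\<close>

definition correct_guesses :: "(nat list \<Rightarrow> nat) \<Rightarrow> nat list \<Rightarrow> nat" where
  "correct_guesses s d = card {i. i < length d \<and> s (take i d) = d ! i}"

text \<open>The largest \<open>j\<close> such that the first \<open>j\<close> revealed cards are \<open>1, \<dots>, j\<close>.\<close>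

definition initial_run :: "nat list \<Rightarrow> nat" where
  "initial_run h = Max {j \<in> {..length h}. take j h = [1..<j+1]}"

text \<open>
  On histories of a riffled deck with at least one card left, \<open>A\<close> and \<open>B\<close> below are not
  both empty after the initial run has been broken, so \<open>Min\<close> is only applied to a nonempty
  set. All cards in \<open>A\<close> are smaller than those in \<open>B\<close>, hence ties go to \<open>A\<close>.
\<close>

definition optimal_guess :: "nat \<Rightarrow> nat list \<Rightarrow> nat" where
  "optimal_guess n h =
     (let j = initial_run h in
      if j = length h then j + 1
      else
        let m = h ! j;
            A = {j+1..<m} - set h;
            B = {m+1..n} - set h
        in if card A \<ge> card B then Min A else Min B)"

definition X :: "nat \<Rightarrow> nat list \<Rightarrow> real" where
  "X n d = real (correct_guesses (optimal_guess n) d)"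

definition mean_X :: "nat \<Rightarrow> real" where
  "mean_X n = measure_pmf.expectation (riffle n) (X n)"

definition central_moment_X :: "nat \<Rightarrow> nat \<Rightarrow> real" where
  "central_moment_X k n =
     measure_pmf.expectation (riffle n) (\<lambda>d. (X n d - mean_X n) ^ k)"

definition even_at_top :: "nat filter" where
  "even_at_top = inf at_top (principal {n. even n})"

end

theory Submission
  imports Defs "HOL-Real_Asymp.Real_Asymp"
begin

text \<open>
  The law of the number of correct guesses is explicit. After the initial run has been broken with
  \<open>N\<close> cards left, the strategy always bets on the longer pile, and among the interleavings of piles of
  sizes \<open>a\<close> and \<open>b\<close> with \<open>a + b = N\<close> exactly \<open>C(N,i) - C(N,i-1)\<close> lead to \<open>i\<close> wrong guesses, for each
  \<open>i \<le> min a b\<close> (\<open>sum_guesses_broken_run\<close>). Summed over all \<open>a + b = N\<close> the weight of \<open>i\<close> is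
  \<open>(N + 1 - 2 * i) * (C(N,i) - C(N,i-1))\<close>: in the variable \<open>R = N + 1 - 2 * i\<close> this is the law of a
  discrete three-dimensional Bessel process, as in Pitman's \<open>2 * M - S\<close> theorem.

  A correct guess of the first card reduces the game to one card less, a wrong one leads to the law
  just described. So the moments of \<open>V = 2 * X + 2 - n\<close> satisfy linear recurrences in \<open>n\<close>
  (\<open>deck_moment_Suc\<close>) whose inhomogeneous terms are the moments of \<open>R\<close>: polynomials in \<open>n\<close>, and
  polynomials times the central binomial probability. The step of the recurrence divides the old
  value by 2, hence any ansatz with a small residual is a good approximation (\<open>bigo_contraction\<close>),
  and for even \<open>n\<close> comparing coefficients gives
  \<open>central_prob * (polynomial in n and 1 / n) + polynomial in n\<close> for the first three moments
  (\<open>deck_moment_1_expansion\<close> and its successors).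

  The central binomial probability itself is expanded to relative precision \<open>n powr (-3)\<close> by Wallis'
  product and telescoping (\<open>central_prob_expansion\<close>). What remains is to express the central moments
  of \<open>X\<close> by the moments of \<open>V\<close> and to collect powers of \<open>sqrt n\<close> and \<open>sqrt (2 / pi)\<close>.
\<close>

section \<open>Guessing card by card\<close>

text \<open>
  The history \<open>h\<close> is an explicit argument so that inductions over the remaining deck can start in
  the middle of a game.
\<close>

primrec guesses_from :: "(nat list \<Rightarrow> nat) \<Rightarrow> nat list \<Rightarrow> nat list \<Rightarrow> nat" where
  "guesses_from s h [] = 0"
| "guesses_from s h (x # d) =
     (if s h = x then Suc (guesses_from s (h @ [x]) d) else guesses_from s (h @ [x]) d)"

lemma card_correct_guesses_from:
  "card {i. i < length d \<and> s (h @ take i d) = d ! i} = guesses_from s h d"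
proof (induction d arbitrary: h)
  case (Cons x d)
  have "{i. i < length (x # d) \<and> s (h @ take i (x # d)) = (x # d) ! i}
      = (if s h = x then {0} else {}) \<union> Suc ` {i. i < length d \<and> s ((h @ [x]) @ take i d) = d ! i}"
    (is "?L = ?R")
  proof (rule set_eqI)
    fix i show "i \<in> ?L \<longleftrightarrow> i \<in> ?R" by (cases i) auto
  qed
  moreover have "card ?R = guesses_from s h (x # d)"
    by (auto simp: card_insert_if card_image Cons.IH[symmetric])
  ultimately show ?case by simp
qed simp

lemma correct_guesses_eq_guesses_from: "correct_guesses s d = guesses_from s [] d"
  using card_correct_guesses_from[of d s "[]"] by (simp add: correct_guesses_def)

lemma initial_run_mem:
  "initial_run h \<in> {j \<in> {..length h}. take j h = [1..<j+1]}"
proof -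
  have "0 \<in> {j \<in> {..length h}. take j h = [1..<j+1]}" by simp
  then show ?thesis unfolding initial_run_def by (intro Max_in) auto
qed

lemma initial_run_le: "initial_run h \<le> length h"
  and take_initial_run: "take (initial_run h) h = [1..<initial_run h + 1]"
  using initial_run_mem[of h] by auto

lemma nth_initial_run_neq:
  assumes "initial_run h < length h"
  shows "h ! initial_run h \<noteq> initial_run h + 1"
proof
  let ?j = "initial_run h"
  assume "h ! ?j = ?j + 1"
  then have "take (Suc ?j) h = [1..<Suc ?j + 1]"
    using assms take_initial_run[of h] by (simp add: take_Suc_conv_app_nth)
  then have "Suc ?j \<in> {j \<in> {..length h}. take j h = [1..<j+1]}" using assms by simp
  then have "Suc ?j \<le> ?j" unfolding initial_run_def by (intro Max_ge) auto
  then show False by simp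
qed

lemma initial_run_eqI:
  assumes "j \<le> length h" "take j h = [1..<j+1]" "j < length h \<Longrightarrow> h ! j \<noteq> j + 1"
  shows "initial_run h = j"
proof (rule antisym)
  show "j \<le> initial_run h" using assms(1,2) unfolding initial_run_def by (intro Max_ge) auto
  show "initial_run h \<le> j"
  proof (rule ccontr)
    assume "\<not> initial_run h \<le> j"
    then have lt: "j < initial_run h" by simp
    then have "h ! j = take (initial_run h) h ! j" by simp
    also have "\<dots> = j + 1" unfolding take_initial_run using lt by (subst nth_upt) auto
    finally show False using assms(3) lt initial_run_le[of h] by simp
  qed
qed

lemma initial_run_upt: "initial_run [1..<j+1] = j"
  by (rule initial_run_eqI) auto

lemma initial_run_append:
  assumes "initial_run h < length h"
  shows "initial_run (h @ [x]) = initial_run h"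
  by (rule initial_run_eqI)
    (use assms take_initial_run[of h] nth_initial_run_neq[of h] in \<open>auto simp: nth_append\<close>)

text \<open>
  The invariant of the game once the initial run is broken: \<open>xs\<close> and \<open>ys\<close> are what is left of
  the two piles, and the history alone determines them as sets. Hence the strategy knows them.
\<close>

definition broken_run_piles :: "nat \<Rightarrow> nat list \<Rightarrow> nat list \<Rightarrow> nat list \<Rightarrow> bool" where
  "broken_run_piles n h xs ys \<longleftrightarrow>
     initial_run h < length h \<and> sorted_wrt (<) xs \<and> sorted_wrt (<) ys \<and>
     set xs = {initial_run h + 1..<h ! initial_run h} - set h \<and>
     set ys = {h ! initial_run h + 1..n} - set h"

lemma broken_run_piles_disjoint:
  "broken_run_piles n h xs ys \<Longrightarrow> set xs \<inter> set ys = {}"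
  by (auto simp: broken_run_piles_def)

lemma broken_run_piles_left:
  assumes "broken_run_piles n h (x # xs) ys"
  shows "broken_run_piles n (h @ [x]) xs ys"
proof -
  have "x \<notin> set xs" "x \<notin> set ys"
    using assms broken_run_piles_disjoint[OF assms] by (auto simp: broken_run_piles_def)
  then show ?thesis
    using assms unfolding broken_run_piles_def
    by (auto simp: initial_run_append nth_append)
qed

lemma broken_run_piles_right:
  assumes "broken_run_piles n h xs (y # ys)"
  shows "broken_run_piles n (h @ [y]) xs ys"
proof -
  have "y \<notin> set xs" "y \<notin> set ys"
    using assms broken_run_piles_disjoint[OF assms] by (auto simp: broken_run_piles_def)
  then show ?thesis
    using assms unfolding broken_run_piles_def
    by (auto simp: initial_run_append nth_append)
qed

lemma optimal_guess_broken_run: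
  assumes "broken_run_piles n h xs ys"
  shows "optimal_guess n h =
    (if length xs \<ge> length ys then Min (set xs) else Min (set ys))"
proof -
  have "distinct xs" "distinct ys"
    using assms by (auto simp: broken_run_piles_def strict_sorted_iff)
  then have "length xs = card (set xs)" "length ys = card (set ys)"
    by (simp_all add: distinct_card)
  then show ?thesis using assms
    by (simp add: optimal_guess_def broken_run_piles_def Let_def)
qed

lemma Min_strict_sorted: "sorted_wrt (<) (x # xs) \<Longrightarrow> Min (set (x # xs)) = (x :: 'a :: linorder)"
  by (intro Min_eqI) auto

text \<open>
  Since the heads differ, conditioning on the first card splits the interleavings without double
  counting.
\<close>

lemma sum_shuffles_Cons:
  assumes "x \<noteq> y"
  shows "sum f (shuffles (x # xs) (y # ys)) =
    (\<Sum>d\<in>shuffles xs (y # ys). f (x # d)) + (\<Sum>d\<in>shuffles (x # xs) ys. f (y # d))"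
proof -
  have "sum f (shuffles (x # xs) (y # ys)) =
      sum f ((#) x ` shuffles xs (y # ys)) + sum f ((#) y ` shuffles (x # xs) ys)"
    unfolding shuffles.simps using assms by (intro sum.union_disjoint) auto
  also have "\<dots> = (\<Sum>d\<in>shuffles xs (y # ys). f (x # d)) + (\<Sum>d\<in>shuffles (x # xs) ys. f (y # d))"
    by (simp add: sum.reindex)
  finally show ?thesis .
qed

section \<open>The wrong guesses after the run is broken\<close>

text \<open>
  The ballot numbers \<open>C(N,i) - C(N,i-1)\<close>, which count the \<open>\<plusminus>1\<close> paths of length \<open>N\<close> with \<open>i\<close> down
  steps that stay nonnegative (for \<open>2 * i \<le> N\<close>).
\<close>

fun ballot :: "nat \<Rightarrow> nat \<Rightarrow> real" where
  "ballot N 0 = 1"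
| "ballot N (Suc i) = real (N choose Suc i) - real (N choose i)"

lemma ballot_Suc_Suc: "ballot (Suc N) (Suc i) = ballot N (Suc i) + ballot N i"
  by (cases i) (simp_all add: binomial_Suc_Suc)

text \<open>
  This zero is what makes ties harmless: from two equal piles a correct guess leaves unequal piles
  whose formula stops one term early, and the missing term is this one.
\<close>

lemma ballot_balanced: "ballot (Suc (2 * a)) (Suc a) = 0"
  using central_binomial_odd[of "Suc (2 * a)"] by simp

lemma ballot_sum_Suc:
  "(\<Sum>i\<le>Suc k. ballot (Suc N) i * g (Suc N - i)) =
     (\<Sum>i\<le>Suc k. ballot N i * g (Suc N - i)) + (\<Sum>i\<le>k. ballot N i * g (N - i))"
  by (simp add: sum.atMost_Suc_shift ballot_Suc_Suc ring_distribs sum.distrib del: ballot.simps(2) sum.atMost_Suc)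

lemma guesses_from_sorted_broken_run:
  assumes "broken_run_piles n h xs ys" "xs = [] \<or> ys = []"
  shows "guesses_from (optimal_guess n) h (xs @ ys) = length xs + length ys"
  using assms
proof (induction "xs @ ys" arbitrary: h xs ys)
  case (Cons z zs)
  show ?case
  proof (cases xs)
    case Nil
    then have ys: "ys = z # zs" using Cons by simp
    have bp: "broken_run_piles n h [] (z # zs)" using Cons Nil ys by simp
    have "optimal_guess n h = z"
      using optimal_guess_broken_run[OF bp] bp Min_strict_sorted[of z zs]
      by (simp add: broken_run_piles_def)
    then show ?thesis
      using Cons.hyps(1)[of "[]" zs "h @ [z]"] broken_run_piles_right[OF bp] Nil ys by simp
  next
    case (Cons a xs')
    then have xs: "xs = z # zs" "ys = []" using Cons.hyps(2) Cons.prems by auto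
    have bp: "broken_run_piles n h (z # zs) []" using Cons.prems xs by simp
    have "optimal_guess n h = z"
      using optimal_guess_broken_run[OF bp] bp Min_strict_sorted[of z zs]
      by (simp add: broken_run_piles_def)
    then show ?thesis
      using Cons.hyps(1)[of zs "[]" "h @ [z]"] broken_run_piles_left[OF bp] xs by simp
  qed
qed simp

text \<open>
  Two piles of sizes \<open>a\<close> and \<open>b\<close> have exactly \<open>ballot (a + b) i\<close> interleavings with \<open>i\<close> wrong guesses,
  for each \<open>i \<le> min a b\<close>. That this number depends on the pile sizes only through their sum and
  the bound on \<open>i\<close> is a discrete form of Pitman's theorem, and it makes the whole game explicitly
  solvable. The induction is Pascal's rule: a correct guess shortens the longer pile and keeps \<open>i\<close>,
  a wrong one shortens the other pile and increases \<open>i\<close>.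
\<close>

lemma sum_guesses_broken_run:
  assumes "broken_run_piles n h xs ys"
  defines "N \<equiv> length xs + length ys"
  shows "(\<Sum>d\<in>shuffles xs ys. g (guesses_from (optimal_guess n) h d)) =
    (\<Sum>i\<le>min (length xs) (length ys). ballot N i * g (N - i))"
  using assms(1) unfolding N_def
proof (induction "length xs + length ys" arbitrary: h xs ys g)
  case 0
  then show ?case by simp
next
  case (Suc K)
  show ?case
  proof (cases "xs = [] \<or> ys = []")
    case True
    then show ?thesis using guesses_from_sorted_broken_run[OF Suc.prems True] by auto
  next
    case False
    then obtain x xs' y ys' where xy: "xs = x # xs'" "ys = y # ys'"
      by (auto simp: neq_Nil_conv)
    define a b where "a = length xs'" and "b = length ys'"
    have K: "K = Suc (a + b)" using Suc.hyps(2) xy by (simp add: a_def b_def)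
    have bp: "broken_run_piles n h (x # xs') (y # ys')" using Suc.prems xy by simp
    have neq: "x \<noteq> y" using broken_run_piles_disjoint[OF bp] by auto
    have sorted: "sorted_wrt (<) (x # xs')" "sorted_wrt (<) (y # ys')"
      using bp unfolding broken_run_piles_def by blast+
    note mins = Min_strict_sorted[OF sorted(1)] Min_strict_sorted[OF sorted(2)]
    have og: "optimal_guess n h = (if a \<ge> b then x else y)"
      using optimal_guess_broken_run[OF bp] mins by (simp add: a_def b_def)
    have L: "(\<Sum>d\<in>shuffles xs' (y # ys'). g' (guesses_from (optimal_guess n) (h @ [x]) d))
        = (\<Sum>i\<le>min a (Suc b). ballot K i * g' (K - i))" for g'
      using Suc.hyps(1)[of xs' "y # ys'" "h @ [x]" g'] broken_run_piles_left[OF bp] K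
      by (simp add: a_def b_def)
    have R: "(\<Sum>d\<in>shuffles (x # xs') ys'. g' (guesses_from (optimal_guess n) (h @ [y]) d))
        = (\<Sum>i\<le>min (Suc a) b. ballot K i * g' (K - i))" for g'
      using Suc.hyps(1)[of "x # xs'" ys' "h @ [y]" g'] broken_run_piles_right[OF bp] K
      by (simp add: a_def b_def)
    have shift: "(\<Sum>i\<le>k. ballot K i * g (Suc (K - i))) = (\<Sum>i\<le>k. ballot K i * g (Suc K - i))"
      if "k \<le> K" for k
      using that by (intro sum.cong) (auto simp: Suc_diff_le)
    have tie: "(\<Sum>i\<le>a. ballot K i * g (Suc K - i)) = (\<Sum>i\<le>Suc a. ballot K i * g (Suc K - i))"
      if "a = b"
      using ballot_balanced[of a] that K by (simp add: mult_2)
    have "(\<Sum>d\<in>shuffles xs ys. g (guesses_from (optimal_guess n) h d)) =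
       (\<Sum>i\<le>Suc (min a b). ballot K i * g (Suc K - i)) + (\<Sum>i\<le>min a b. ballot K i * g (K - i))"
    proof (cases "a \<ge> b")
      case True
      then have mb: "min (Suc a) b = b" by simp
      have "(\<Sum>d\<in>shuffles xs ys. g (guesses_from (optimal_guess n) h d)) =
        (\<Sum>i\<le>min a (Suc b). ballot K i * g (Suc K - i)) + (\<Sum>i\<le>b. ballot K i * g (K - i))"
        using True neq L[of "\<lambda>c. g (Suc c)"] R[of g] shift[of "min a (Suc b)"] K
        unfolding xy sum_shuffles_Cons[OF neq] guesses_from.simps og mb
        by (simp del: sum.atMost_Suc)
      moreover have "(\<Sum>i\<le>min a (Suc b). ballot K i * g (Suc K - i)) =
          (\<Sum>i\<le>Suc b. ballot K i * g (Suc K - i))"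
      proof (cases "a = b")
        case True then show ?thesis using tie by simp
      next
        case False
        then have "min a (Suc b) = Suc b" using True by simp
        then show ?thesis by (simp only:)
      qed
      ultimately show ?thesis using True by (simp add: min_def)
    next
      case False
      then have m: "min (Suc a) b = Suc a" "min a (Suc b) = a" "min a b = a" by auto
      show ?thesis
        using False neq L[of g] R[of "\<lambda>c. g (Suc c)"] shift[of "Suc a"] K
        unfolding xy sum_shuffles_Cons[OF neq] guesses_from.simps og m
        by simp
    qed
    also have "\<dots> = (\<Sum>i\<le>Suc (min a b). ballot (Suc K) i * g (Suc K - i))"
      by (rule ballot_sum_Suc[symmetric])
    finally show ?thesis using K by (simp add: xy a_def b_def)
  qed
qed

section \<open>The whole game\<close>

lemma optimal_guess_upt: "optimal_guess n [1..<j+1] = j + 1"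
  unfolding optimal_guess_def initial_run_upt Let_def by simp

lemma guesses_from_sorted_deck:
  assumes "j \<le> n"
  shows "guesses_from (optimal_guess n) [1..<j+1] [j+1..<n+1] = n - j"
  using assms
proof (induction rule: inc_induct)
  case (step j)
  have deck: "[j+1..<n+1] = (j+1) # [Suc j+1..<n+1]"
    using step.hyps by (subst upt_conv_Cons) auto
  have history: "[1..<j+1] @ [j+1] = [1..<Suc j+1]" by simp
  show ?case
    using step.IH step.hyps unfolding deck guesses_from.simps optimal_guess_upt history
    by simp
qed simp

text \<open>
  The total of \<open>g\<close> (number of correct guesses) over the interleavings of piles of sizes \<open>a\<close> and \<open>b\<close>
  that are left while the initial run is intact. A card from the first pile continues the run; a
  card from the second pile is a wrong guess and starts the broken phase with that pile one card
  shorter. If one pile is empty then the rest of the deck is sorted and every guess is correct.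
\<close>

fun run_sum :: "(nat \<Rightarrow> real) \<Rightarrow> nat \<Rightarrow> nat \<Rightarrow> real" where
  "run_sum g 0 b = g b"
| "run_sum g (Suc a) 0 = g (Suc a)"
| "run_sum g (Suc a) (Suc b) = run_sum (\<lambda>c. g (Suc c)) a (Suc b)
     + (\<Sum>i\<le>min (Suc a) b. ballot (Suc a + b) i * g (Suc a + b - i))"

lemma run_sum_right_0: "run_sum g a 0 = g a"
  by (cases a) auto

lemma broken_run_piles_first:
  assumes "j < t" "t < n"
  shows "broken_run_piles n ([1..<j+1] @ [t+1]) [j+1..<t+1] [t+2..<n+1]"
proof -
  have "initial_run ([1..<j+1] @ [t+1]) = j"
    by (rule initial_run_eqI) (use assms in \<open>auto simp: nth_append\<close>)
  then show ?thesis
    using assms by (auto simp: broken_run_piles_def nth_append simp del: upt_Suc)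
qed

lemma sum_guesses_intact_run:
  assumes "j \<le> t" "t \<le> n"
  shows "(\<Sum>d\<in>shuffles [j+1..<t+1] [t+1..<n+1].
            g (guesses_from (optimal_guess n) [1..<j+1] d)) = run_sum g (t - j) (n - t)"
  using assms
proof (induction "t - j" arbitrary: j g)
  case 0
  then have "t = j" by simp
  then show ?case using guesses_from_sorted_deck[of j n] 0 by (simp del: upt_Suc)
next
  case (Suc a)
  show ?case
  proof (cases "t = n")
    case True
    have "shuffles xs [] = {xs}" for xs :: "nat list" by (cases xs) auto
    then show ?thesis using True guesses_from_sorted_deck[of j n] Suc.hyps(2) Suc.prems
      by (simp add: run_sum_right_0 del: upt_Suc)
  next
    case False
    then have less: "j < t" "t < n" using Suc by auto
    then obtain b where b: "n - t = Suc b" by (cases "n - t") auto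
    have a: "a = t - Suc j" using Suc.hyps(2) by simp
    let ?G = "guesses_from (optimal_guess n)"
    have xs: "[j+1..<t+1] = (j+1) # [Suc j+1..<t+1]" and ys: "[t+1..<n+1] = (t+1) # [t+2..<n+1]"
      using less by (subst upt_conv_Cons; simp)+
    have run: "[1..<j+1] @ [j+1] = [1..<Suc j+1]" by simp
    have "(\<Sum>d\<in>shuffles [j+1..<t+1] [t+1..<n+1]. g (?G [1..<j+1] d)) =
        (\<Sum>d\<in>shuffles [Suc j+1..<t+1] [t+1..<n+1]. g (?G [1..<j+1] ((j+1) # d)))
      + (\<Sum>d\<in>shuffles [j+1..<t+1] [t+2..<n+1]. g (?G [1..<j+1] ((t+1) # d)))"
      unfolding xs ys using less by (subst sum_shuffles_Cons) auto
    also have "(\<Sum>d\<in>shuffles [Suc j+1..<t+1] [t+1..<n+1]. g (?G [1..<j+1] ((j+1) # d)))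
        = run_sum (\<lambda>c. g (Suc c)) a (Suc b)"
      using Suc.hyps(1)[of "Suc j" "\<lambda>c. g (Suc c)"] a less b
      unfolding guesses_from.simps optimal_guess_upt run by (simp del: upt_Suc)
    also have "(\<Sum>d\<in>shuffles [j+1..<t+1] [t+2..<n+1]. g (?G [1..<j+1] ((t+1) # d)))
        = (\<Sum>i\<le>min (Suc a) b. ballot (Suc a + b) i * g (Suc a + b - i))"
    proof -
      have "length [j+1..<t+1] = Suc a" "length [t+2..<n+1] = b"
        unfolding length_upt using Suc.hyps(2) b by arith+
      then show ?thesis
        using sum_guesses_broken_run[OF broken_run_piles_first[OF less], of g] less
        unfolding guesses_from.simps optimal_guess_upt by (simp del: upt_Suc)
    qed
    finally show ?thesis using b by (simp flip: Suc.hyps(2))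
  qed
qed

text \<open>
  All \<open>2 ^ n\<close> pairs of a cut position and an interleaving are equally likely, so expectations are
  plain sums over them.
\<close>

definition guess_sum :: "(nat \<Rightarrow> real) \<Rightarrow> nat \<Rightarrow> real" where
  "guess_sum g n = (\<Sum>t\<le>n. run_sum g t (n - t))"

lemma expectation_riffle_guesses:
  "measure_pmf.expectation (riffle n) (\<lambda>d. g (correct_guesses (optimal_guess n) d)) =
     guess_sum g n / 2 ^ n"
proof -
  let ?S = "\<lambda>t. shuffles [1..<t+1] [t+1..<n+1]"
  let ?f = "\<lambda>d. g (correct_guesses (optimal_guess n) d) :: real"
  have ne: "?S t \<noteq> {}" for t using splice_in_shuffles by blast
  have fin: "finite (set_pmf (pmf_of_set (?S t)))" for t
    unfolding set_pmf_of_set[OF ne finite_shuffles] by (rule finite_shuffles)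
  have "measure_pmf.expectation (riffle n) ?f =
      (\<Sum>t\<le>n. pmf (binomial_pmf n (1/2)) t *\<^sub>R measure_pmf.expectation (pmf_of_set (?S t)) ?f)"
    unfolding riffle_def using fin by (intro pmf_expectation_bind) simp_all
  also have "\<dots> = (\<Sum>t\<le>n. run_sum g t (n - t) / 2 ^ n)"
  proof (rule sum.cong[OF refl])
    fix t assume "t \<in> {..n}"
    then have t: "t \<le> n" by simp
    have "(\<Sum>d\<in>?S t. ?f d) = run_sum g t (n - t)"
      using sum_guesses_intact_run[of 0 t n g] t
      by (simp add: correct_guesses_eq_guesses_from del: upt_Suc)
    then have "measure_pmf.expectation (pmf_of_set (?S t)) ?f =
        run_sum g t (n - t) / real (card (?S t))"
      unfolding integral_pmf_of_set[OF ne finite_shuffles] by simp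
    moreover have "card (?S t) = n choose t"
      using t by (subst card_disjoint_shuffles) (auto simp del: upt_Suc)
    moreover have "pmf (binomial_pmf n (1/2)) t = real (n choose t) / 2 ^ n"
      using t by (simp add: power_divide flip: power_add)
    moreover have "n choose t > 0" using t by simp
    ultimately show "pmf (binomial_pmf n (1/2)) t *\<^sub>R
        measure_pmf.expectation (pmf_of_set (?S t)) ?f = run_sum g t (n - t) / 2 ^ n"
      by (simp del: upt_Suc)
  qed
  finally show ?thesis by (simp add: guess_sum_def sum_divide_distrib)
qed

definition broken_sum :: "(nat \<Rightarrow> real) \<Rightarrow> nat \<Rightarrow> real" where
  "broken_sum g N = (\<Sum>i\<le>N div 2. real (N + 1 - 2 * i) * ballot N i * g (N - i))"

text \<open>
  There are \<open>N + 1 - 2 * i\<close> ways to split \<open>N\<close> cards into two piles of at least \<open>i\<close> cards each.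
\<close>

lemma broken_sum_eq:
  "(\<Sum>t\<le>N. \<Sum>i\<le>min t (N - t). ballot N i * g (N - i)) = broken_sum g N"
proof -
  let ?h = "\<lambda>i. ballot N i * g (N - i)"
  have "(\<Sum>t\<le>N. \<Sum>i\<le>min t (N - t). ?h i) =
      (\<Sum>t\<le>N. \<Sum>i | i \<in> {..N div 2} \<and> i \<le> t \<and> t \<le> N - i. ?h i)"
    by (intro sum.cong refl arg_cong[where f = "sum ?h"]) auto
  also have "\<dots> = (\<Sum>i\<le>N div 2. \<Sum>t | t \<in> {..N} \<and> i \<le> t \<and> t \<le> N - i. ?h i)"
    by (rule sum.swap_restrict) auto
  also have "\<dots> = broken_sum g N"
    unfolding broken_sum_def
  proof (rule sum.cong[OF refl])
    fix i assume "i \<in> {..N div 2}"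
    then have "{t \<in> {..N}. i \<le> t \<and> t \<le> N - i} = {i..N - i}" "Suc (N - i) - i = N + 1 - 2 * i"
      by auto
    then show "(\<Sum>t | t \<in> {..N} \<and> i \<le> t \<and> t \<le> N - i. ?h i) =
        real (N + 1 - 2 * i) * ballot N i * g (N - i)"
      by simp
  qed
  finally show ?thesis .
qed

lemma guess_sum_0: "guess_sum g 0 = g 0"
  by (simp add: guess_sum_def)

text \<open>
  Conditioning on the first card of a deck of \<open>n + 1\<close> cards: if it comes from the first pile, a game
  with \<open>n\<close> cards remains; if it comes from the second pile, the broken phase with \<open>n\<close> cards starts.
  The last two terms correct for the cut with empty first pile, where the first card comes from the
  second pile but the deck is sorted.
\<close>

lemma guess_sum_Suc:
  "guess_sum g (Suc n) =
     guess_sum (\<lambda>c. g (Suc c)) n + broken_sum g n + g (Suc n) - g n"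
proof -
  let ?g = "\<lambda>c. g (Suc c)"
  let ?B = "\<lambda>t. \<Sum>i\<le>min t (n - t). ballot n i * g (n - i)"
  have split: "(\<Sum>t\<le>n. G t) = (\<Sum>t<n. G t) + G n" for G :: "nat \<Rightarrow> real"
    unfolding lessThan_Suc_atMost[symmetric] by (rule sum.lessThan_Suc)
  have "run_sum g (Suc t) (n - t) = run_sum ?g t (n - t) + ?B (Suc t)" if "t < n" for t
  proof -
    obtain b where "n - t = Suc b" using \<open>t < n\<close> by (cases "n - t") auto
    moreover from this have "n - Suc t = b" "Suc (t + b) = n" using that by simp_all
    ultimately show ?thesis by simp
  qed
  then have "(\<Sum>t<n. run_sum g (Suc t) (n - t)) = (\<Sum>t<n. run_sum ?g t (n - t)) + (\<Sum>t<n. ?B (Suc t))"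
    by (simp add: sum.distrib)
  moreover have "guess_sum g (Suc n) =
      g (Suc n) + ((\<Sum>t<n. run_sum g (Suc t) (n - t)) + g (Suc n))"
    unfolding guess_sum_def
    by (simp add: sum.atMost_Suc_shift split run_sum_right_0 del: sum.atMost_Suc)
  moreover have "guess_sum ?g n = (\<Sum>t<n. run_sum ?g t (n - t)) + g (Suc n)"
    unfolding guess_sum_def by (simp add: split run_sum_right_0)
  moreover have "broken_sum g n = g n + (\<Sum>t<n. ?B (Suc t))"
    unfolding broken_sum_eq[symmetric] by (subst sum.atMost_shift) simp
  ultimately show ?thesis by simp
qed

section \<open>Exact recurrences for the moments\<close>

lemma run_sum_add: "run_sum (\<lambda>c. f c + g c) a b = run_sum f a b + run_sum g a b"
  by (induction f a b arbitrary: g rule: run_sum.induct) (simp_all add: ring_distribs sum.distrib)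

lemma run_sum_cmult: "run_sum (\<lambda>c. r * f c) a b = r * run_sum f a b"
  by (induction f a b rule: run_sum.induct)
    (simp_all add: ring_distribs sum_distrib_left mult.left_commute)

lemma guess_sum_add: "guess_sum (\<lambda>c. f c + g c) n = guess_sum f n + guess_sum g n"
  by (simp add: guess_sum_def run_sum_add sum.distrib)

lemma guess_sum_cmult: "guess_sum (\<lambda>c. r * f c) n = r * guess_sum f n"
  by (simp add: guess_sum_def run_sum_cmult sum_distrib_left)

text \<open>
  Moments of \<open>R = N + 1 - 2 * i\<close>, where \<open>i\<close> is the number of wrong guesses, under the ballot weights.
  The factor \<open>N + 1 - 2 * i\<close> of \<open>broken_sum\<close> is one more factor \<open>R\<close>, so the game needs the orders 1
  to 4.
\<close>

definition ballot_moment :: "nat \<Rightarrow> nat \<Rightarrow> real" where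
  "ballot_moment k N = (\<Sum>i\<le>N div 2. (real N + 1 - 2 * real i) ^ k * ballot N i) / 2 ^ N"

lemma ballot_moment_0: "ballot_moment 0 N = real (N choose (N div 2)) / 2 ^ N"
proof -
  have "(\<Sum>i\<le>m. ballot N i) = real (N choose m)" for m
    by (induction m) simp_all
  then show ?thesis by (simp add: ballot_moment_def)
qed

lemma sum_ballot_Suc:
  "(\<Sum>i\<le>m. F i * ballot (Suc N) i) =
     (\<Sum>i\<le>m. F i * ballot N i) + (\<Sum>i<m. F (Suc i) * ballot N i)"
  by (induction m) (simp_all add: ballot_Suc_Suc ring_distribs del: ballot.simps(2))

text \<open>
  The recurrence of the ballot numbers moves \<open>R\<close> by \<open>\<plusminus>1\<close>, so \<open>R ^ k\<close> turns into
  \<open>(R + 1) ^ k + (R - 1) ^ k\<close>. The ends of the summation range contribute nothing: for odd \<open>N\<close> the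
  extra ballot number vanishes, for even \<open>N\<close> the extra power is \<open>0 ^ k\<close>. Odd orders close among
  themselves, even orders are driven by the central binomial probability of order 0.
\<close>

lemma ballot_moment_Suc:
  assumes "k > 0" and poly: "\<And>r::real. (r + 1) ^ k + (r - 1) ^ k = 2 * r ^ k + b * r ^ l + c"
  shows "ballot_moment k (Suc N) =
    ballot_moment k N + b / 2 * ballot_moment l N + c / 2 * ballot_moment 0 N"
proof -
  define r where "r i = real N + 1 - 2 * real i" for i
  define S where "S j = (\<Sum>i\<le>N div 2. r i ^ j * ballot N i)" for j
  define F where "F i = (real N + 2 - 2 * real i) ^ k" for i
  have "(\<Sum>i\<le>Suc N div 2. F i * ballot (Suc N) i) =
      (\<Sum>i\<le>N div 2. F i * ballot N i) + (\<Sum>i\<le>N div 2. F (Suc i) * ballot N i)"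
  proof (cases "even N")
    case True
    then obtain a where a: "N = 2 * a" by (elim evenE)
    then have div: "Suc N div 2 = a" "N div 2 = a" by simp_all
    have "F (Suc a) = 0" using assms a by (simp add: F_def)
    then have "(\<Sum>i\<le>a. F (Suc i) * ballot N i) = (\<Sum>i<a. F (Suc i) * ballot N i)"
      unfolding lessThan_Suc_atMost[symmetric] sum.lessThan_Suc by simp
    then show ?thesis unfolding div sum_ballot_Suc by simp
  next
    case False
    then obtain a where a: "N = 2 * a + 1" by (elim oddE)
    then have div: "Suc N div 2 = Suc a" "N div 2 = a" by simp_all
    have "ballot N (Suc a) = 0" using ballot_balanced[of a] a by simp
    then show ?thesis
      unfolding div sum_ballot_Suc lessThan_Suc_atMost sum.atMost_Suc by simp
  qed
  also have "\<dots> = (\<Sum>i\<le>N div 2. (F i + F (Suc i)) * ballot N i)"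
    by (simp add: ring_distribs sum.distrib)
  also have "\<dots> = (\<Sum>i\<le>N div 2. (2 * r i ^ k + b * r i ^ l + c) * ballot N i)"
  proof -
    have "F i + F (Suc i) = 2 * r i ^ k + b * r i ^ l + c" for i
      using poly[of "r i"] by (simp add: F_def r_def algebra_simps)
    then show ?thesis by simp
  qed
  also have "\<dots> = 2 * S k + b * S l + c * S 0"
    by (simp add: S_def ring_distribs sum.distrib sum_distrib_left mult.assoc)
  finally have "ballot_moment k (Suc N) = (2 * S k + b * S l + c * S 0) / 2 ^ Suc N"
    by (simp add: ballot_moment_def F_def algebra_simps)
  moreover have "ballot_moment j N = S j / 2 ^ N" for j
    by (simp add: ballot_moment_def S_def r_def)
  ultimately show ?thesis by (simp add: add_divide_distrib)
qed

lemma ballot_moment_1: "ballot_moment 1 N = 1"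
proof (induction N)
  case (Suc N)
  then show ?case using ballot_moment_Suc[of 1 0 0 0 N] by simp
qed (simp add: ballot_moment_def)

lemma ballot_moment_2_Suc: "ballot_moment 2 (Suc N) = ballot_moment 2 N + ballot_moment 0 N"
proof -
  have "(r + 1) ^ 2 + (r - 1) ^ 2 = 2 * r ^ 2 + 0 * r ^ 0 + 2" for r :: real by algebra
  from ballot_moment_Suc[OF _ this] show ?thesis by simp
qed

lemma ballot_moment_3: "ballot_moment 3 N = 3 * real N + 1"
proof (induction N)
  case (Suc N)
  have "(r + 1) ^ 3 + (r - 1) ^ 3 = 2 * r ^ 3 + 6 * r ^ 1 + 0" for r :: real by algebra
  from ballot_moment_Suc[OF _ this]
  have "ballot_moment 3 (Suc N) = ballot_moment 3 N + 3 * ballot_moment 1 N" by simp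
  then show ?case using Suc by (simp add: ballot_moment_1[simplified])
qed (simp add: ballot_moment_def)

lemma ballot_moment_4_Suc:
  "ballot_moment 4 (Suc N) = ballot_moment 4 N + 6 * ballot_moment 2 N + ballot_moment 0 N"
proof -
  have "(r + 1) ^ 4 + (r - 1) ^ 4 = 2 * r ^ 4 + 12 * r ^ 2 + 2" for r :: real by algebra
  from ballot_moment_Suc[OF _ this] show ?thesis by simp
qed

definition central_prob :: "nat \<Rightarrow> real" where
  "central_prob k = real ((2 * k) choose k) / 4 ^ k"

lemma binomial_middle_odd:
  "real (Suc (2 * k) choose k) = real (2 * k choose k) * (2 * real k + 1) / (real k + 1)"
proof -
  have "Suc k * (Suc (2 * k) choose k) = Suc (2 * k) * (2 * k choose k)"
    using binomial_absorb_comp[of "Suc (2 * k)" k] by (simp add: Suc_diff_le)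
  from arg_cong[OF this, of real]
  have "(real k + 1) * real (Suc (2 * k) choose k) = (2 * real k + 1) * real (2 * k choose k)"
    by (simp only: of_nat_mult of_nat_Suc) (simp add: algebra_simps)
  then show ?thesis by (simp add: eq_divide_eq mult.commute)
qed

lemma central_prob_Suc: "central_prob (Suc k) = central_prob k * (2 * real k + 1) / (2 * real k + 2)"
proof -
  have "2 * Suc k choose Suc k = 2 * (Suc (2 * k) choose k)"
    using central_binomial_odd[of "Suc (2 * k)"] by simp
  then have middle: "real (2 * Suc k choose Suc k) = 2 * real (Suc (2 * k) choose k)"
    by simp
  have two: "2 * real k + 2 = 2 * (real k + 1)" by simp
  show ?thesis unfolding central_prob_def middle binomial_middle_odd two
    by (simp only: power_Suc) (simp del: distrib_left_numeral add: mult_ac)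
qed

lemma ballot_moment_0_even: "ballot_moment 0 (2 * k) = central_prob k"
  by (simp add: ballot_moment_0 central_prob_def power_mult)

lemma ballot_moment_0_odd:
  "ballot_moment 0 (Suc (2 * k)) = central_prob k * (2 * real k + 1) / (2 * real k + 2)"
proof -
  have "(2::real) ^ (2 * k) = 4 ^ k" by (simp add: power_mult)
  moreover have "Suc (2 * k) div 2 = k" by simp
  ultimately show ?thesis
    unfolding ballot_moment_0 central_prob_def power_Suc
    by (simp only: binomial_middle_odd) (simp add: divide_simps)
qed

lemma ballot_moment_2_even: "ballot_moment 2 (2 * k) = (4 * real k + 1) * central_prob k"
  and ballot_moment_2_odd: "ballot_moment 2 (Suc (2 * k)) = (4 * real k + 2) * central_prob k"
proof -
  have odd: "ballot_moment 2 (Suc (2 * k)) = (4 * real k + 2) * central_prob k"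
    if "ballot_moment 2 (2 * k) = (4 * real k + 1) * central_prob k" for k
    unfolding ballot_moment_2_Suc ballot_moment_0_even that by (simp add: algebra_simps)
  show even: "ballot_moment 2 (2 * k) = (4 * real k + 1) * central_prob k"
  proof (induction k)
    case 0
    show ?case by (simp add: ballot_moment_def central_prob_def)
  next
    case (Suc k)
    have "ballot_moment 2 (2 * Suc k) = ballot_moment 2 (Suc (2 * k)) + ballot_moment 0 (Suc (2 * k))"
      using ballot_moment_2_Suc[of "Suc (2 * k)"] by simp
    also have "\<dots> = (4 * real (Suc k) + 1) * central_prob (Suc k)"
      unfolding odd[OF Suc] ballot_moment_0_odd central_prob_Suc by (simp add: field_simps)
    finally show ?case .
  qed
  show "ballot_moment 2 (Suc (2 * k)) = (4 * real k + 2) * central_prob k"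
    by (rule odd[OF even])
qed

lemma ballot_moment_4_even:
    "ballot_moment 4 (2 * k) = (32 * real k ^ 2 + 8 * real k + 1) * central_prob k"
  and ballot_moment_4_odd:
    "ballot_moment 4 (Suc (2 * k)) = 8 * (2 * real k + 1) ^ 2 * central_prob k"
proof -
  have odd: "ballot_moment 4 (Suc (2 * k)) = 8 * (2 * real k + 1) ^ 2 * central_prob k"
    if "ballot_moment 4 (2 * k) = (32 * real k ^ 2 + 8 * real k + 1) * central_prob k" for k
    unfolding ballot_moment_4_Suc ballot_moment_2_even ballot_moment_0_even that
    by (simp add: algebra_simps power2_eq_square)
  show even: "ballot_moment 4 (2 * k) = (32 * real k ^ 2 + 8 * real k + 1) * central_prob k"
  proof (induction k)
    case 0
    show ?case by (simp add: ballot_moment_def central_prob_def)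
  next
    case (Suc k)
    have "ballot_moment 4 (2 * Suc k) = ballot_moment 4 (Suc (2 * k))
        + 6 * ballot_moment 2 (Suc (2 * k)) + ballot_moment 0 (Suc (2 * k))"
      using ballot_moment_4_Suc[of "Suc (2 * k)"] by simp
    also have "\<dots> = (32 * real (Suc k) ^ 2 + 8 * real (Suc k) + 1) * central_prob (Suc k)"
      unfolding odd[OF Suc] ballot_moment_2_odd ballot_moment_0_odd central_prob_Suc
      by (simp add: field_simps power2_eq_square)
    finally show ?case .
  qed
  show "ballot_moment 4 (Suc (2 * k)) = 8 * (2 * real k + 1) ^ 2 * central_prob k"
    by (rule odd[OF even])
qed

text \<open>
  The variable \<open>V = 2 * X + 2 - n\<close> is of size \<open>sqrt n\<close>, and it equals \<open>R\<close> when the very first card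
  breaks the run, while a correct first guess increases it by 1; so its recurrences have constant
  coefficients.
\<close>

definition deck_moment :: "nat \<Rightarrow> nat \<Rightarrow> real" where
  "deck_moment k n = guess_sum (\<lambda>c. (2 * real c + 2 - real n) ^ k) n / 2 ^ n"

lemma deck_moment_Suc:
  "deck_moment k (Suc n) =
     (guess_sum (\<lambda>c. ((2 * real c + 2 - real n) + 1) ^ k) n / 2 ^ n + ballot_moment (Suc k) n) / 2
     + ((real n + 3) ^ k - (real n + 1) ^ k) / 2 ^ Suc n"
proof -
  let ?g = "\<lambda>c. (2 * real c + 2 - real (Suc n)) ^ k"
  have "broken_sum ?g n = ballot_moment (Suc k) n * 2 ^ n"
    unfolding broken_sum_def ballot_moment_def
    by (auto intro!: sum.cong simp: of_nat_diff algebra_simps)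
  moreover have "(\<lambda>c. ?g (Suc c)) = (\<lambda>c. ((2 * real c + 2 - real n) + 1) ^ k)"
    by (simp add: algebra_simps)
  ultimately have "guess_sum ?g (Suc n) =
      guess_sum (\<lambda>c. ((2 * real c + 2 - real n) + 1) ^ k) n + ballot_moment (Suc k) n * 2 ^ n
      + ((real n + 3) ^ k - (real n + 1) ^ k)"
    by (simp add: guess_sum_Suc algebra_simps)
  then show ?thesis
    unfolding deck_moment_def by (simp add: add_divide_distrib diff_divide_distrib)
qed

lemma deck_moment_0: "deck_moment 0 n = 1"
proof (induction n)
  case 0
  show ?case by (simp add: deck_moment_def guess_sum_0)
next
  case (Suc n)
  have "deck_moment 0 (Suc n) = (deck_moment 0 n + ballot_moment 1 n) / 2"
    using deck_moment_Suc[of 0 n] by (simp add: deck_moment_def[of 0 n])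
  then show ?case by (simp only: Suc ballot_moment_1) simp
qed

lemma guess_sum_cubic:
  "guess_sum (\<lambda>c. a0 + a1 * (2 * real c + 2 - real n) + a2 * (2 * real c + 2 - real n) ^ 2
       + a3 * (2 * real c + 2 - real n) ^ 3) n / 2 ^ n
   = a0 + a1 * deck_moment 1 n + a2 * deck_moment 2 n + a3 * deck_moment 3 n"
proof -
  have "guess_sum (\<lambda>c. 1) n / 2 ^ n = 1"
    using deck_moment_0[of n] by (simp only: deck_moment_def power_0)
  moreover have "guess_sum (\<lambda>c. a0) n = a0 * guess_sum (\<lambda>c. 1) n"
    using guess_sum_cmult[of a0 "\<lambda>c. 1" n] by simp
  ultimately have "guess_sum (\<lambda>c. a0) n / 2 ^ n = a0"
    by (metis mult.right_neutral times_divide_eq_right)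
  then show ?thesis
    by (simp only: guess_sum_add guess_sum_cmult deck_moment_def add_divide_distrib
        power_one_right times_divide_eq_right)
qed

lemma deck_moment_1_Suc:
  "deck_moment 1 (Suc n) = (1 + deck_moment 1 n + ballot_moment 2 n) / 2 + 2 / 2 ^ Suc n"
  using deck_moment_Suc[of 1 n] guess_sum_cubic[of 1 1 n 0 0]
  by (simp add: numeral_2_eq_2 algebra_simps)

lemma deck_moment_2_Suc:
  "deck_moment 2 (Suc n) = (1 + 2 * deck_moment 1 n + deck_moment 2 n + ballot_moment 3 n) / 2
     + (4 * real n + 8) / 2 ^ Suc n"
proof -
  have "(r + 1) ^ 2 = 1 + 2 * r + 1 * r ^ 2 + 0 * r ^ 3" for r :: real by algebra
  moreover have "(real n + 3) ^ 2 - (real n + 1) ^ 2 = 4 * real n + 8" by algebra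
  ultimately show ?thesis
    using deck_moment_Suc[of 2 n] by (simp only: guess_sum_cubic) (simp add: numeral_3_eq_3 numeral_2_eq_2)
qed

lemma deck_moment_3_Suc:
  "deck_moment 3 (Suc n) =
     (1 + 3 * deck_moment 1 n + 3 * deck_moment 2 n + deck_moment 3 n + ballot_moment 4 n) / 2
     + (6 * real n ^ 2 + 24 * real n + 26) / 2 ^ Suc n"
proof -
  have "(r + 1) ^ 3 = 1 + 3 * r + 3 * r ^ 2 + 1 * r ^ 3" for r :: real by algebra
  moreover have "(real n + 3) ^ 3 - (real n + 1) ^ 3 = 6 * real n ^ 2 + 24 * real n + 26" by algebra
  moreover have "Suc 3 = 4" by simp
  ultimately show ?thesis
    using deck_moment_Suc[of 3 n] by (simp only: guess_sum_cubic) simp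
qed

text \<open>
  Two cards at a time, because \<open>ballot_moment\<close> of even order has different closed forms for even and
  odd decks.
\<close>

lemma deck_moment_1_even_Suc:
  "deck_moment 1 (2 * Suc k) = deck_moment 1 (2 * k) / 4 + 3 / 4
     + (12 * real k + 5) / 4 * central_prob k + 1 / 4 ^ k"
  and deck_moment_2_even_Suc:
  "deck_moment 2 (2 * Suc k) = deck_moment 2 (2 * k) / 4 + deck_moment 1 (2 * k)
     + 9 / 2 * real k + 7 / 2 + (4 * real k + 1) / 2 * central_prob k + (4 * real k + 6) / 4 ^ k"
  and deck_moment_3_even_Suc:
  "deck_moment 3 (2 * Suc k) = deck_moment 3 (2 * k) / 4 + 3 / 2 * deck_moment 2 (2 * k)
     + 3 * deck_moment 1 (2 * k) + 9 / 2 * real k + 3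
     + (24 * real k ^ 2 + 21 * real k + 5) * central_prob k
     + (12 * real k ^ 2 + 36 * real k + 28) / 4 ^ k"
proof -
  have double: "2 * Suc k = Suc (Suc (2 * k))" "(2::real) ^ (2 * k) = 4 ^ k"
    by (simp_all add: power_mult)
  show "deck_moment 1 (2 * Suc k) = deck_moment 1 (2 * k) / 4 + 3 / 4
     + (12 * real k + 5) / 4 * central_prob k + 1 / 4 ^ k"
    unfolding double deck_moment_1_Suc ballot_moment_2_odd ballot_moment_2_even power_Suc
    by (simp add: field_simps)
  show "deck_moment 2 (2 * Suc k) = deck_moment 2 (2 * k) / 4 + deck_moment 1 (2 * k)
     + 9 / 2 * real k + 7 / 2 + (4 * real k + 1) / 2 * central_prob k + (4 * real k + 6) / 4 ^ k"
    unfolding double deck_moment_2_Suc deck_moment_1_Suc ballot_moment_3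
      ballot_moment_2_odd ballot_moment_2_even power_Suc of_nat_Suc of_nat_mult
    by (simp add: field_simps)
  show "deck_moment 3 (2 * Suc k) = deck_moment 3 (2 * k) / 4 + 3 / 2 * deck_moment 2 (2 * k)
     + 3 * deck_moment 1 (2 * k) + 9 / 2 * real k + 3
     + (24 * real k ^ 2 + 21 * real k + 5) * central_prob k
     + (12 * real k ^ 2 + 36 * real k + 28) / 4 ^ k"
    unfolding double deck_moment_3_Suc deck_moment_2_Suc deck_moment_1_Suc ballot_moment_3
      ballot_moment_4_odd ballot_moment_4_even ballot_moment_2_odd ballot_moment_2_even
      power_Suc of_nat_Suc of_nat_mult
    by (simp add: field_simps power2_eq_square)
qed

lemma expectation_riffle_X:
  "measure_pmf.expectation (riffle n) (\<lambda>d. g (X n d)) = guess_sum (\<lambda>c. g (real c)) n / 2 ^ n"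
  unfolding X_def by (rule expectation_riffle_guesses)

lemma mean_X_eq: "mean_X n = (deck_moment 1 n + real n - 2) / 2"
proof -
  have "mean_X n = guess_sum (\<lambda>c. real c) n / 2 ^ n"
    using expectation_riffle_X[of n "\<lambda>x. x"] by (simp add: mean_X_def)
  also have "(\<lambda>c. real c) = (\<lambda>c. (real n - 2) / 2 + 1 / 2 * (2 * real c + 2 - real n)
      + 0 * (2 * real c + 2 - real n) ^ 2 + 0 * (2 * real c + 2 - real n) ^ 3)"
    by (simp add: field_simps)
  finally show ?thesis unfolding guess_sum_cubic by (simp add: field_simps)
qed

lemma central_moment_X_2: "central_moment_X 2 n = (deck_moment 2 n - deck_moment 1 n ^ 2) / 4"
proof -
  let ?m = "deck_moment 1 n"
  have "central_moment_X 2 n = guess_sum (\<lambda>c. (real c - mean_X n) ^ 2) n / 2 ^ n"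
    unfolding central_moment_X_def by (rule expectation_riffle_X)
  also have "(\<lambda>c. (real c - mean_X n) ^ 2) =
      (\<lambda>c. ?m ^ 2 / 4 + (- ?m / 2) * (2 * real c + 2 - real n)
        + 1 / 4 * (2 * real c + 2 - real n) ^ 2 + 0 * (2 * real c + 2 - real n) ^ 3)"
    unfolding mean_X_eq by (rule ext) (simp add: field_simps power2_eq_square)
  finally show ?thesis unfolding guess_sum_cubic by (simp add: field_simps power2_eq_square)
qed

lemma central_moment_X_3:
  "central_moment_X 3 n =
     (deck_moment 3 n - 3 * deck_moment 1 n * deck_moment 2 n + 2 * deck_moment 1 n ^ 3) / 8"
proof -
  let ?m = "deck_moment 1 n"
  have "central_moment_X 3 n = guess_sum (\<lambda>c. (real c - mean_X n) ^ 3) n / 2 ^ n"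
    unfolding central_moment_X_def by (rule expectation_riffle_X)
  also have "(\<lambda>c. (real c - mean_X n) ^ 3) =
      (\<lambda>c. - (?m ^ 3) / 8 + 3 * ?m ^ 2 / 8 * (2 * real c + 2 - real n)
        + (- 3 * ?m / 8) * (2 * real c + 2 - real n) ^ 2 + 1 / 8 * (2 * real c + 2 - real n) ^ 3)"
    unfolding mean_X_eq by (rule ext) (simp add: field_simps power2_eq_square power3_eq_cube)
  finally show ?thesis
    unfolding guess_sum_cubic by (simp add: field_simps power2_eq_square power3_eq_cube)
qed

section \<open>Asymptotic expansions from recurrences\<close>

text \<open>
  An approximate solution of a contracting recurrence is an approximation of the solution: the
  residual of one step, as long as it decays slower than the contraction, dominates the error.
\<close>

lemma bigo_contraction:
  fixes e g :: "nat \<Rightarrow> real"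
  assumes step: "(\<lambda>k. e (Suc k) - e k / 4) \<in> O(g)"
    and pos: "eventually (\<lambda>k. g k > 0) at_top"
    and slow: "eventually (\<lambda>k. g k \<le> 2 * g (Suc k)) at_top"
  shows "e \<in> O(g)"
proof -
  obtain c where c: "c > 0" "eventually (\<lambda>k. norm (e (Suc k) - e k / 4) \<le> c * norm (g k)) at_top"
    using landau_o.bigE[OF step] by blast
  have "eventually (\<lambda>k. \<bar>e (Suc k) - e k / 4\<bar> \<le> c * g k \<and> g k > 0 \<and> g k \<le> 2 * g (Suc k)) at_top"
    using c(2) pos slow by eventually_elim auto
  then obtain K where
    K: "\<And>k. k \<ge> K \<Longrightarrow> \<bar>e (Suc k) - e k / 4\<bar> \<le> c * g k \<and> g k > 0 \<and> g k \<le> 2 * g (Suc k)"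
    unfolding eventually_at_top_linorder by blast
  define C where "C = max (4 * c) (\<bar>e K\<bar> / g K)"
  have C: "4 * c \<le> C" "\<bar>e K\<bar> \<le> C * g K"
    using K[of K] by (auto simp: C_def field_simps max_def)
  have "\<bar>e k\<bar> \<le> C * g k" if "k \<ge> K" for k
    using that
  proof (induction k rule: dec_induct)
    case base
    show ?case by (rule C)
  next
    case (step k)
    have "\<bar>e (Suc k)\<bar> \<le> \<bar>e k\<bar> / 4 + c * g k" using K[of k] step.hyps by linarith
    also have "\<dots> \<le> C * g k / 4 + C / 4 * g k"
      using step C(1) K[of k] by (intro add_mono mult_right_mono) auto
    also have "\<dots> = C / 2 * g k" by simp
    also have "\<dots> \<le> C / 2 * (2 * g (Suc k))"
      using step K[of k] C(1) c(1) by (intro mult_left_mono) auto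
    finally show ?case by simp
  qed
  then have "norm (e k) \<le> C * norm (g k)" if "k \<ge> K" for k
    using that K[of k] by simp
  then show ?thesis
    by (intro bigoI[of _ C]) (auto simp: eventually_at_top_linorder)
qed

text \<open>
  The error of a convergent sequence is the sum of the remaining increments.
\<close>

lemma bigo_telescope:
  fixes r \<phi> :: "nat \<Rightarrow> real"
  assumes lim: "r \<longlonglongrightarrow> L" and null: "\<phi> \<longlonglongrightarrow> 0"
    and decr: "eventually (\<lambda>k. \<phi> (Suc k) \<le> \<phi> k) at_top"
    and step: "(\<lambda>k. r (Suc k) - r k) \<in> O(\<lambda>k. \<phi> k - \<phi> (Suc k))"
  shows "(\<lambda>k. r k - L) \<in> O(\<phi>)"
proof -
  obtain c where c: "c > 0"
    "eventually (\<lambda>k. norm (r (Suc k) - r k) \<le> c * norm (\<phi> k - \<phi> (Suc k))) at_top"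
    using landau_o.bigE[OF step] by blast
  have "eventually (\<lambda>k. \<bar>r (Suc k) - r k\<bar> \<le> c * (\<phi> k - \<phi> (Suc k))) at_top"
    using c(2) decr by eventually_elim auto
  then obtain K where K: "\<And>k. k \<ge> K \<Longrightarrow> \<bar>r (Suc k) - r k\<bar> \<le> c * (\<phi> k - \<phi> (Suc k))"
    unfolding eventually_at_top_linorder by blast
  have "\<bar>r k - L\<bar> \<le> c * \<phi> k" if "k \<ge> K" for k
  proof -
    have "\<bar>r k - r m\<bar> \<le> c * (\<phi> k - \<phi> m)" if "m \<ge> k" for m
      using that
    proof (induction m rule: dec_induct)
      case (step m)
      then show ?case using K[of m] \<open>k \<ge> K\<close> by (simp add: algebra_simps)
    qed simp
    moreover have "(\<lambda>m. \<bar>r k - r m\<bar>) \<longlonglongrightarrow> \<bar>r k - L\<bar>"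
      by (intro tendsto_intros lim)
    moreover have "(\<lambda>m. c * (\<phi> k - \<phi> m)) \<longlonglongrightarrow> c * (\<phi> k - 0)"
      by (intro tendsto_intros null)
    ultimately have "\<bar>r k - L\<bar> \<le> c * (\<phi> k - 0)"
      by (intro LIMSEQ_le[of "\<lambda>m. \<bar>r k - r m\<bar>" _ "\<lambda>m. c * (\<phi> k - \<phi> m)"]) auto
    then show ?thesis by simp
  qed
  then have "norm (r k - L) \<le> c * norm (\<phi> k)" if "k \<ge> K" for k
    using that c(1) by (smt (verit) mult_left_mono real_norm_def)
  then show ?thesis
    by (intro bigoI[of _ c]) (auto simp: eventually_at_top_linorder)
qed

section \<open>The central binomial probability\<close>

lemma central_prob_0: "central_prob 0 = 1"
  by (simp add: central_prob_def)

lemma central_prob_pos: "central_prob k > 0"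
  by (simp add: central_prob_def)

lemma central_prob_wallis: "(\<lambda>k. central_prob k ^ 2 * (2 * real k + 1)) \<longlonglongrightarrow> 2 / pi"
proof -
  have prod: "(\<Prod>j=1..k. (4 * real j ^ 2) / (4 * real j ^ 2 - 1))
      = inverse (central_prob k ^ 2 * (2 * real k + 1))" for k
  proof (induction k)
    case (Suc k)
    have "4 * real (Suc k) ^ 2 - 1 = (2 * real k + 1) * (2 * real k + 3)"
      by (simp add: algebra_simps power2_eq_square)
    then show ?case
      using Suc central_prob_pos[of k]
      by (simp add: central_prob_Suc field_simps power2_eq_square)
  qed (simp add: central_prob_0)
  have "(\<lambda>k. inverse (central_prob k ^ 2 * (2 * real k + 1))) \<longlonglongrightarrow> pi / 2"
    using wallis by (simp only: prod)
  from tendsto_inverse[OF this] show ?thesis by simp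
qed

text \<open>
  The beginning of the asymptotic series of \<open>C(n,n/2) / 2 ^ n\<close> at \<open>n = 2 * k\<close> up to the factor
  \<open>sqrt (2 / pi)\<close>, namely \<open>(1 - 1 / (4 * n) + 1 / (32 * n ^ 2)) / sqrt n\<close>.
\<close>

definition central_approx :: "nat \<Rightarrow> real" where
  "central_approx k = (1 - 1 / (8 * real k) + 1 / (128 * real k ^ 2)) / sqrt (2 * real k)"

text \<open>
  The quotient of the squares is a sequence whose consecutive ratios are explicit rational functions
  \<open>1 + O(1 / k ^ 4)\<close>; the coefficients of the series are chosen for exactly this. Wallis' product
  gives the limit of the quotient, and telescoping gives the error \<open>O(1 / k ^ 3)\<close>.
\<close>

lemma central_prob_expansion:
  "(\<lambda>k. central_prob k - sqrt (2 / pi) * central_approx k) \<in> O(\<lambda>k. real k powr (-7/2))"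
proof -
  define T where "T k = (1 - 1 / (8 * real k) + 1 / (128 * real k ^ 2)) ^ 2 / (2 * real k)" for k
  define \<sigma> where "\<sigma> k = ((2 * real k + 1) / (2 * real k + 2)) ^ 2 * T k / T (Suc k) - 1" for k
  define r where "r k = central_prob k ^ 2 / T k" for k
  define s where "s = sqrt (2 / pi)"
  have s: "s > 0" "s ^ 2 = 2 / pi" by (simp_all add: s_def)
  have T_pos: "eventually (\<lambda>k. T k > 0) at_top" unfolding T_def by real_asymp
  have root_pos: "eventually (\<lambda>k. central_approx k > 0) at_top"
    unfolding central_approx_def by real_asymp
  have T_eq: "T k = central_approx k ^ 2" for k
    by (simp add: T_def central_approx_def power_divide)
  have "(\<lambda>k. central_prob k ^ 2 * (2 * real k + 1) * (1 / (T k * (2 * real k + 1)))) \<longlonglongrightarrow> 2 / pi * 1"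
    by (rule tendsto_mult[OF central_prob_wallis]) (unfold T_def, real_asymp)
  then have lim: "r \<longlonglongrightarrow> s ^ 2"
    by (simp add: r_def[abs_def] s(2) add_pos_nonneg pos_add_strict)
  have "(\<lambda>k. r (Suc k) - r k) \<in> O(\<lambda>k. 1 / real k ^ 3 - 1 / real (Suc k) ^ 3)"
  proof -
    have ratio: "eventually (\<lambda>k. r (Suc k) - r k = r k * \<sigma> k) at_top"
      using T_pos eventually_sequentially_Suc[THEN iffD2, OF T_pos]
      by eventually_elim
        (simp add: r_def \<sigma>_def central_prob_Suc field_simps power2_eq_square)
    have "(\<lambda>k. r k * \<sigma> k) \<in> O(\<lambda>k. 1 * (1 / real k ^ 3 - 1 / real (Suc k) ^ 3))"
    proof (rule landau_o.big.mult)
      show "r \<in> O(\<lambda>_. 1)" using lim by (intro bigoI_tendsto[of _ _ "s ^ 2"]) simp_all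
      show "\<sigma> \<in> O(\<lambda>k. 1 / real k ^ 3 - 1 / real (Suc k) ^ 3)"
        unfolding \<sigma>_def T_def by real_asymp
    qed
    then show ?thesis using landau_o.big.in_cong[OF ratio] by simp
  qed
  then have "(\<lambda>k. r k - s ^ 2) \<in> O(\<lambda>k. 1 / real k ^ 3)"
    by (intro bigo_telescope[OF lim]) real_asymp+
  moreover have "central_approx \<in> O(\<lambda>k. real k powr (-1/2))"
    unfolding central_approx_def by real_asymp
  ultimately have "(\<lambda>k. central_approx k * (r k - s ^ 2)) \<in> O(\<lambda>k. real k powr (-1/2) * (1 / real k ^ 3))"
    by (rule landau_o.big.mult[rotated])
  also have "(\<lambda>k. real k powr (-1/2) * (1 / real k ^ 3)) \<in> O(\<lambda>k. real k powr (-7/2))"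
    by real_asymp
  finally have small: "(\<lambda>k. central_approx k * (r k - s ^ 2)) \<in> O(\<lambda>k. real k powr (-7/2))" .
  have "eventually (\<lambda>k. norm (central_prob k - s * central_approx k)
      \<le> 1 / s * norm (central_approx k * (r k - s ^ 2))) at_top"
    using root_pos
  proof eventually_elim
    case (elim k)
    let ?b = "central_prob k" and ?t = "central_approx k"
    have "?t * (r k - s ^ 2) = (?b - s * ?t) * ((?b + s * ?t) / ?t)"
      using elim by (simp add: r_def T_eq field_simps power2_eq_square)
    then have "\<bar>?b - s * ?t\<bar> * \<bar>(?b + s * ?t) / ?t\<bar> = \<bar>?t * (r k - s ^ 2)\<bar>"
      by (simp only: abs_mult)
    moreover have "(?b + s * ?t) / ?t \<ge> s"
      using elim central_prob_pos[of k] by (simp add: field_simps)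
    then have "s \<le> \<bar>(?b + s * ?t) / ?t\<bar>"
      by (rule order_trans) (rule abs_ge_self)
    then have "\<bar>?b - s * ?t\<bar> * s \<le> \<bar>?b - s * ?t\<bar> * \<bar>(?b + s * ?t) / ?t\<bar>"
      by (rule mult_left_mono) (rule abs_ge_zero)
    moreover have "x \<le> 1 / s * y" if "x * s \<le> y" for x y
      using that s(1) by (simp add: field_simps)
    ultimately show ?case by (simp only: real_norm_def)
  qed
  then have "(\<lambda>k. central_prob k - s * central_approx k) \<in> O(\<lambda>k. central_approx k * (r k - s ^ 2))"
    by (rule bigoI)
  with small show ?thesis unfolding s_def by (rule landau_o.big_trans[rotated])
qed

lemma central_prob_bigo: "central_prob \<in> O(\<lambda>k. real k powr (-1/2))"
proof -
  have "central_approx \<in> O(\<lambda>k. real k powr (-1/2))"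
    unfolding central_approx_def by real_asymp
  then have "(\<lambda>k. sqrt (2 / pi) * central_approx k) \<in> O(\<lambda>k. real k powr (-1/2))"
    by simp
  moreover have "(\<lambda>k. central_prob k - sqrt (2 / pi) * central_approx k) \<in> O(\<lambda>k. real k powr (-1/2))"
    by (rule landau_o.big_trans[OF central_prob_expansion]) real_asymp
  ultimately have "(\<lambda>k. (central_prob k - sqrt (2 / pi) * central_approx k)
      + sqrt (2 / pi) * central_approx k) \<in> O(\<lambda>k. real k powr (-1/2))"
    by (rule sum_in_bigo(1)[rotated])
  then show ?thesis by simp
qed

lemma central_prob_mult_bigo:
  assumes "f \<in> O(\<lambda>k. real k powr (a + 1/2))"
  shows "(\<lambda>k. central_prob k * f k) \<in> O(\<lambda>k. real k powr a)"
proof -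
  have "(\<lambda>k. central_prob k * f k) \<in> O(\<lambda>k. real k powr (-1/2) * real k powr (a + 1/2))"
    by (rule landau_o.big.mult[OF central_prob_bigo assms])
  then show ?thesis by (simp flip: powr_add)
qed

section \<open>Expansions of the moments for even decks\<close>

text \<open>
  The moments satisfy \<open>m (k + 1) = m k / 4 + ...\<close> with right-hand sides built from
  \<open>central_prob k\<close> and polynomials in \<open>k\<close>. Inserting
  \<open>central_prob k * (polynomial in k and 1 / k) + (polynomial in k)\<close> and comparing coefficients
  determines the approximations below; \<open>?p\<close> is what remains of the coefficient of \<open>central_prob k\<close>.
  The mean needs the relative precision \<open>1 / k ^ 3\<close>, since in the third central moment it is
  multiplied by the second moment, which is of order \<open>k\<close>.
\<close>

lemma deck_moment_1_expansion:
  "(\<lambda>k. deck_moment 1 (2 * k) - (central_prob k * (4 * real k - 1 - 2 / (3 * real k)) + 1))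
     \<in> O(\<lambda>k. real k powr (-5/2))" (is "?e \<in> _")
proof (rule bigo_contraction)
  let ?p = "\<lambda>k. (12 * real k + 5) / 4 + (4 * real k - 1 - 2 / (3 * real k)) / 4
    - (2 * real k + 1) / (2 * real k + 2) * (4 * real (Suc k) - 1 - 2 / (3 * real (Suc k)))"
  have "?p \<in> O(\<lambda>k. real k powr (-5/2 + 1/2))" by real_asymp
  note p = central_prob_mult_bigo[OF this]
  have exp: "(\<lambda>k. 1 / 4 ^ k :: real) \<in> O(\<lambda>k. real k powr (-5/2))" by real_asymp
  have "?e (Suc k) - ?e k / 4 = central_prob k * ?p k + 1 / 4 ^ k" for k
    unfolding deck_moment_1_even_Suc central_prob_Suc
    by (simp add: algebra_simps add_divide_distrib diff_divide_distrib)
  then show "(\<lambda>k. ?e (Suc k) - ?e k / 4) \<in> O(\<lambda>k. real k powr (-5/2))"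
    using sum_in_bigo(1)[OF p exp] by (simp only:)
qed real_asymp+

lemma deck_moment_2_expansion:
  "(\<lambda>k. deck_moment 2 (2 * k) - (central_prob k * (8 * real k - 6) + (6 * real k - 2)))
     \<in> O(\<lambda>k. real k powr (-3/2))" (is "?e \<in> _")
proof (rule bigo_contraction)
  let ?e1 = "\<lambda>k. deck_moment 1 (2 * k) - (central_prob k * (4 * real k - 1 - 2 / (3 * real k)) + 1)"
  let ?p = "\<lambda>k. (4 * real k + 1) / 2 + (8 * real k - 6) / 4 + (4 * real k - 1 - 2 / (3 * real k))
    - (2 * real k + 1) / (2 * real k + 2) * (8 * real (Suc k) - 6)"
  have "?p \<in> O(\<lambda>k. real k powr (-3/2 + 1/2))" by real_asymp
  note p = central_prob_mult_bigo[OF this]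
  have exp: "(\<lambda>k. (4 * real k + 6) / 4 ^ k) \<in> O(\<lambda>k. real k powr (-3/2))" by real_asymp
  have e1: "?e1 \<in> O(\<lambda>k. real k powr (-3/2))"
    by (rule landau_o.big_trans[OF deck_moment_1_expansion]) real_asymp
  have "?e (Suc k) - ?e k / 4 = ?e1 k + (central_prob k * ?p k + (4 * real k + 6) / 4 ^ k)" for k
    unfolding deck_moment_2_even_Suc central_prob_Suc
    by (simp add: algebra_simps add_divide_distrib diff_divide_distrib)
  then show "(\<lambda>k. ?e (Suc k) - ?e k / 4) \<in> O(\<lambda>k. real k powr (-3/2))"
    using sum_in_bigo(1)[OF e1 sum_in_bigo(1)[OF p exp]] by (simp only:)
qed real_asymp+

lemma deck_moment_3_expansion:
  "(\<lambda>k. deck_moment 3 (2 * k)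
       - (central_prob k * (32 * real k ^ 2 - 4 * real k - 28) + (18 * real k - 20)))
     \<in> O(\<lambda>k. real k powr (-3/2))" (is "?e \<in> _")
proof (rule bigo_contraction)
  let ?e1 = "\<lambda>k. deck_moment 1 (2 * k) - (central_prob k * (4 * real k - 1 - 2 / (3 * real k)) + 1)"
  let ?e2 = "\<lambda>k. deck_moment 2 (2 * k) - (central_prob k * (8 * real k - 6) + (6 * real k - 2))"
  let ?p = "\<lambda>k. 24 * real k ^ 2 + 21 * real k + 5 + (32 * real k ^ 2 - 4 * real k - 28) / 4
    + 3 / 2 * (8 * real k - 6) + 3 * (4 * real k - 1 - 2 / (3 * real k))
    - (2 * real k + 1) / (2 * real k + 2) * (32 * real (Suc k) ^ 2 - 4 * real (Suc k) - 28)"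
  have "?p \<in> O(\<lambda>k. real k powr (-3/2 + 1/2))" by real_asymp
  note p = central_prob_mult_bigo[OF this]
  have exp: "(\<lambda>k. (12 * real k ^ 2 + 36 * real k + 28) / 4 ^ k) \<in> O(\<lambda>k. real k powr (-3/2))"
    by real_asymp
  have "?e1 \<in> O(\<lambda>k. real k powr (-3/2))"
    by (rule landau_o.big_trans[OF deck_moment_1_expansion]) real_asymp
  then have e1: "(\<lambda>k. 3 * ?e1 k) \<in> O(\<lambda>k. real k powr (-3/2))"
    by (intro landau_o.big.cmult_in_iff[THEN iffD2]) simp_all
  have e2: "(\<lambda>k. 3 / 2 * ?e2 k) \<in> O(\<lambda>k. real k powr (-3/2))"
    by (intro landau_o.big.cmult_in_iff[THEN iffD2] deck_moment_2_expansion) simp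
  have "?e (Suc k) - ?e k / 4 = 3 / 2 * ?e2 k + (3 * ?e1 k
      + (central_prob k * ?p k + (12 * real k ^ 2 + 36 * real k + 28) / 4 ^ k))" for k
    unfolding deck_moment_3_even_Suc central_prob_Suc
    by (simp add: algebra_simps add_divide_distrib diff_divide_distrib)
  then show "(\<lambda>k. ?e (Suc k) - ?e k / 4) \<in> O(\<lambda>k. real k powr (-3/2))"
    using sum_in_bigo(1)[OF e2 sum_in_bigo(1)[OF e1 sum_in_bigo(1)[OF p exp]]] by (simp only:)
qed real_asymp+

lemma central_prob_replace:
  assumes "(\<lambda>k. m k - (central_prob k * f k + g k)) \<in> O(\<lambda>k. real k powr a)"
    and "f \<in> O(\<lambda>k. real k powr (a + 7/2))"
  shows "(\<lambda>k. m k - (sqrt (2 / pi) * (central_approx k * f k) + g k)) \<in> O(\<lambda>k. real k powr a)"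
proof -
  have "(\<lambda>k. (central_prob k - sqrt (2 / pi) * central_approx k) * f k)
      \<in> O(\<lambda>k. real k powr (-7/2) * real k powr (a + 7/2))"
    by (rule landau_o.big.mult[OF central_prob_expansion assms(2)])
  also have "(\<lambda>k. real k powr (-7/2) * real k powr (a + 7/2)) = (\<lambda>k. real k powr a)"
    by (simp flip: powr_add)
  finally have "(\<lambda>k. (m k - (central_prob k * f k + g k))
      + (central_prob k - sqrt (2 / pi) * central_approx k) * f k) \<in> O(\<lambda>k. real k powr a)"
    by (rule sum_in_bigo(1)[OF assms(1)])
  then show ?thesis by (simp add: algebra_simps)
qed

section \<open>The central moments\<close>

lemma bigo_even_at_top:
  fixes f g :: "nat \<Rightarrow> real"
  assumes "(\<lambda>k. f (2 * k)) \<in> O(\<lambda>k. g (2 * k))"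
  shows "f \<in> O[even_at_top](g)"
proof -
  obtain c where "eventually (\<lambda>k. norm (f (2 * k)) \<le> c * norm (g (2 * k))) at_top"
    using landau_o.bigE[OF assms] by blast
  then obtain K where K: "\<And>k. k \<ge> K \<Longrightarrow> norm (f (2 * k)) \<le> c * norm (g (2 * k))"
    unfolding eventually_at_top_linorder by blast
  have "norm (f n) \<le> c * norm (g n)" if "n \<ge> 2 * K" "even n" for n
    using that K by (elim evenE) auto
  then show ?thesis
    unfolding even_at_top_def
    by (intro bigoI[of _ c]) (auto simp: eventually_inf_principal eventually_at_top_linorder)
qed

lemma bigo_powr_mult:
  fixes f g :: "nat \<Rightarrow> real"
  assumes "f \<in> O(\<lambda>k. real k powr a)" "g \<in> O(\<lambda>k. real k powr b)" "a + b \<le> c"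
  shows "(\<lambda>k. f k * g k) \<in> O(\<lambda>k. real k powr c)"
proof -
  have "(\<lambda>k. f k * g k) \<in> O(\<lambda>k. real k powr a * real k powr b)"
    by (rule landau_o.big.mult[OF assms(1,2)])
  also have "(\<lambda>k. real k powr a * real k powr b) = (\<lambda>k. real k powr (a + b))"
    by (simp add: powr_add)
  also have "(\<lambda>k. real k powr (a + b)) \<in> O(\<lambda>k. real k powr c)"
    using assms(3) by (intro bigoI[of _ 1] eventually_mono[OF eventually_ge_at_top[of 1]])
      (simp add: powr_mono)
  finally show ?thesis .
qed

text \<open>
  From here on all expansions are written in \<open>s = sqrt n\<close> with \<open>n = 2 * k\<close>. In this variable they are
  rational functions with rational coefficients, which makes the cancellations below a matter of
  comparing leading terms. The three shapes are the coefficients of \<open>sqrt (2 / pi)\<close> in the first three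
  moments.
\<close>

definition sqrt_series :: "real \<Rightarrow> real" where
  "sqrt_series s = (1 - 1 / (4 * s ^ 2) + 1 / (32 * s ^ 4)) / s"

definition shape1 :: "real \<Rightarrow> real" where "shape1 s = sqrt_series s * (2 * s ^ 2 - 1 - 4 / (3 * s ^ 2))"
definition shape2 :: "real \<Rightarrow> real" where "shape2 s = sqrt_series s * (4 * s ^ 2 - 6)"
definition shape3 :: "real \<Rightarrow> real" where "shape3 s = sqrt_series s * (8 * s ^ 4 - 2 * s ^ 2 - 28)"

lemma central_approx_eq_sqrt: "central_approx k = sqrt_series (sqrt (2 * real k))"
proof -
  have "sqrt (2 * real k) ^ 4 = (sqrt (2 * real k) ^ 2) ^ 2"
    unfolding power_mult[symmetric] by simp
  then show ?thesis by (simp add: central_approx_def sqrt_series_def power_mult_distrib)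
qed

text \<open>
  With \<open>c = sqrt (2 / pi)\<close>, the central moments are polynomials in \<open>c\<close> whose coefficients depend on
  \<open>s\<close>. The first two facts compare the coefficients of \<open>c\<close> and \<open>c ^ 2\<close> in four times the variance
  with the claimed expansion, the next three those of \<open>c\<close>, \<open>c ^ 2\<close> and \<open>c ^ 3\<close> in eight times the
  third central moment. The last two give the size of the factors of the error terms.
\<close>

lemma shape_cancellation:
  "(\<lambda>s. shape2 s - 2 * shape1 s + 4 / s) \<in> O(\<lambda>s. 1 / s ^ 3)"
  "(\<lambda>s. 4 * s ^ 2 - 6 - 11 / (6 * s ^ 2) - shape1 s ^ 2) \<in> O(\<lambda>s. 1 / s ^ 3)"
  "(\<lambda>s. shape3 s - 3 * shape2 s - 3 * shape1 s * (3 * s ^ 2 - 2) + 6 * shape1 s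
      + 10 * s ^ 3 - 43 / 2 * s + 241 / 16 * (1 / s)) \<in> O(\<lambda>s. 1 / s ^ 2)"
  "(\<lambda>s. 6 * shape1 s ^ 2 - 3 * shape1 s * shape2 s - 24) \<in> O(\<lambda>s. 1 / s ^ 2)"
  "(\<lambda>s. 2 * shape1 s ^ 3 - 16 * s ^ 3 + 36 * s - 5 / 2 * (1 / s)) \<in> O(\<lambda>s. 1 / s ^ 2)"
  "shape1 \<in> O(\<lambda>s. s)" "shape2 \<in> O(\<lambda>s. s)"
  unfolding shape1_def shape2_def shape3_def sqrt_series_def by real_asymp+

lemma bigo_sqrt_double:
  fixes f g :: "real \<Rightarrow> real"
  assumes "f \<in> O(g)" "(\<lambda>k. g (sqrt (2 * real k))) \<in> O(\<lambda>k. real k powr c)"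
  shows "(\<lambda>k. f (sqrt (2 * real k))) \<in> O(\<lambda>k. real k powr c)"
proof -
  have "filterlim (\<lambda>k. sqrt (2 * real k)) at_top at_top" by real_asymp
  from landau_o.big.compose[OF assms(1) this] show ?thesis
    by (rule landau_o.big_trans[OF _ assms(2)])
qed

lemma deck_moment_even_expansions:
  defines "s \<equiv> \<lambda>k. sqrt (2 * real k)" and "c \<equiv> sqrt (2 / pi)"
  shows
  "(\<lambda>k. deck_moment 1 (2 * k) - (c * shape1 (s k) + 1)) \<in> O(\<lambda>k. real k powr (-5/2))"
  "(\<lambda>k. deck_moment 2 (2 * k) - (c * shape2 (s k) + (3 * s k ^ 2 - 2))) \<in> O(\<lambda>k. real k powr (-3/2))"
  "(\<lambda>k. deck_moment 3 (2 * k) - (c * shape3 (s k) + (9 * s k ^ 2 - 20))) \<in> O(\<lambda>k. real k powr (-3/2))"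
proof -
  have s2: "s k ^ 2 = 2 * real k" for k by (simp add: s_def)
  have s4: "s k ^ 4 = 4 * real k ^ 2" for k
    using power_mult[of "s k" 2 2] by (simp add: s2 power_mult_distrib)
  have sqrt_series: "sqrt_series (s k) = central_approx k" for k by (simp add: s_def central_approx_eq_sqrt)
  have mu: "shape1 (s k) = central_approx k * (4 * real k - 1 - 2 / (3 * real k))"
      "shape2 (s k) = central_approx k * (8 * real k - 6)"
      "shape3 (s k) = central_approx k * (32 * real k ^ 2 - 4 * real k - 28)"
      "3 * s k ^ 2 - 2 = 6 * real k - 2" "9 * s k ^ 2 - 20 = 18 * real k - 20" for k
    by (simp_all add: shape1_def shape2_def shape3_def sqrt_series s2 s4)
  show "(\<lambda>k. deck_moment 1 (2 * k) - (c * shape1 (s k) + 1)) \<in> O(\<lambda>k. real k powr (-5/2))"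
    unfolding mu c_def by (rule central_prob_replace[OF deck_moment_1_expansion]) real_asymp
  show "(\<lambda>k. deck_moment 2 (2 * k) - (c * shape2 (s k) + (3 * s k ^ 2 - 2))) \<in> O(\<lambda>k. real k powr (-3/2))"
    unfolding mu c_def by (rule central_prob_replace[OF deck_moment_2_expansion]) real_asymp
  show "(\<lambda>k. deck_moment 3 (2 * k) - (c * shape3 (s k) + (9 * s k ^ 2 - 20))) \<in> O(\<lambda>k. real k powr (-3/2))"
    unfolding mu c_def by (rule central_prob_replace[OF deck_moment_3_expansion]) real_asymp
qed

theorem mainTheorem3:
  shows
    "(\<lambda>n. central_moment_X 2 n
        - ((3/4 - 2/pi) * real n - 3/4 + 3/pi - sqrt (2 / (pi * real n))
           + 11 / (12 * pi * real n)))
       \<in> O[even_at_top](\<lambda>n. real n powr (-3/2))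
     \<and>
     (\<lambda>n. central_moment_X 3 n
        - sqrt (2/pi) *
          ((4/pi - 5/4) * real n powr (3/2) + (43/16 - 9/pi) * real n powr (1/2)
           - 3 * sqrt (2 * pi) / 4 + 3 * sqrt (2/pi)
           - (241/128 - 5 / (8 * pi)) * (1 / sqrt (real n))))
       \<in> O[even_at_top](\<lambda>n. 1 / real n)"
proof (intro conjI bigo_even_at_top)
  define s where "s k = sqrt (2 * real k)" for k
  define c where "c = sqrt (2 / pi)"
  define E1 where "E1 k = deck_moment 1 (2 * k) - (c * shape1 (s k) + 1)" for k
  define E2 where "E2 k = deck_moment 2 (2 * k) - (c * shape2 (s k) + (3 * s k ^ 2 - 2))" for k
  define E3 where "E3 k = deck_moment 3 (2 * k) - (c * shape3 (s k) + (9 * s k ^ 2 - 20))" for k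
  define A1 where "A1 k = c * shape1 (s k) + 1" for k
  define A2 where "A2 k = c * shape2 (s k) + (3 * s k ^ 2 - 2)" for k
  have m: "deck_moment 1 (2 * k) = A1 k + E1 k" "deck_moment 2 (2 * k) = A2 k + E2 k"
    "deck_moment 3 (2 * k) = c * shape3 (s k) + (9 * s k ^ 2 - 20) + E3 k" for k
    by (simp_all add: E1_def E2_def E3_def A1_def A2_def)
  have E: "E1 \<in> O(\<lambda>k. real k powr (-5/2))" "E2 \<in> O(\<lambda>k. real k powr (-3/2))"
      "E3 \<in> O(\<lambda>k. real k powr (-3/2))"
    using deck_moment_even_expansions
    by (simp_all only: E1_def[abs_def] E2_def[abs_def] E3_def[abs_def] s_def[abs_def] c_def)
  have A1: "A1 \<in> O(\<lambda>k. real k powr (1/2))"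
  proof -
    have "(\<lambda>k. shape1 (s k)) \<in> O(\<lambda>k. real k powr (1/2))"
      unfolding s_def by (rule bigo_sqrt_double[OF shape_cancellation(6)]) real_asymp
    moreover have "(\<lambda>k. 1) \<in> O(\<lambda>k. real k powr (1/2))" by real_asymp
    ultimately show ?thesis unfolding A1_def[abs_def]
      by (intro sum_in_bigo(1) landau_o.big.mult_in_1) simp_all
  qed
  have A2: "A2 \<in> O(\<lambda>k. real k powr 1)"
  proof -
    have "(\<lambda>k. shape2 (s k)) \<in> O(\<lambda>k. real k powr 1)"
      unfolding s_def by (rule bigo_sqrt_double[OF shape_cancellation(7)]) real_asymp
    moreover have "(\<lambda>k. 3 * s k ^ 2 - 2) \<in> O(\<lambda>k. real k powr 1)"
      unfolding s_def by real_asymp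
    ultimately show ?thesis unfolding A2_def[abs_def]
      by (intro sum_in_bigo(1) landau_o.big.mult_in_1) simp_all
  qed
  have pi_eq: "pi = 2 / c ^ 2" and c_pos: "c > 0" by (simp_all add: c_def)
  have s2: "s k ^ 2 = real (2 * k)" for k by (simp add: s_def)

  \<comment> \<open>The claimed terms are subtracted coefficientwise in \<open>c\<close>; the remaining terms of \<open>?D2\<close> and
     \<open>?D3\<close> come from the errors \<open>E1\<close>, \<open>E2\<close>, \<open>E3\<close>.\<close>
  let ?P2 = "\<lambda>k. shape2 (s k) - 2 * shape1 (s k) + 4 / s k"
  let ?Q2 = "\<lambda>k. 4 * s k ^ 2 - 6 - 11 / (6 * s k ^ 2) - shape1 (s k) ^ 2"
  have P2: "?P2 \<in> O(\<lambda>k. real k powr (-3/2))" and Q2: "?Q2 \<in> O(\<lambda>k. real k powr (-3/2))"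
    unfolding s_def
    by (rule bigo_sqrt_double[OF shape_cancellation(1)] bigo_sqrt_double[OF shape_cancellation(2)]; real_asymp)+
  have target2: "(3/4 - 2/pi) * real (2 * k) - 3/4 + 3/pi - sqrt (2 / (pi * real (2 * k)))
           + 11 / (12 * pi * real (2 * k))
      = (3/4 - c ^ 2) * s k ^ 2 - 3/4 + 3 / 2 * c ^ 2 - c / s k + 11 / 24 * c ^ 2 / s k ^ 2" for k
  proof -
    have "sqrt (2 / (pi * real (2 * k))) = c / s k"
      by (simp add: c_def s_def real_sqrt_divide real_sqrt_mult)
    moreover have "2 / pi = c ^ 2" "3 / pi = 3 / 2 * c ^ 2"
      "11 / (12 * pi * real (2 * k)) = 11 / 24 * c ^ 2 / s k ^ 2"
      using c_pos by (simp_all add: pi_eq s2)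
    ultimately show ?thesis by (simp only: s2)
  qed
  let ?D2 = "\<lambda>k. E2 k - 2 * (A1 k * E1 k) - E1 k * E1 k + c * ?P2 k + c ^ 2 * ?Q2 k"
  have D2: "?D2 \<in> O(\<lambda>k. real k powr (-3/2))"
    by (intro sum_in_bigo E(2) landau_o.big.cmult_in_iff[THEN iffD2] disjI2 P2 Q2
        bigo_powr_mult[OF A1 E(1)] bigo_powr_mult[OF E(1) E(1)]) (use c_pos in auto)
  have "central_moment_X 2 (2 * k)
      - ((3/4 - 2/pi) * real (2 * k) - 3/4 + 3/pi - sqrt (2 / (pi * real (2 * k)))
           + 11 / (12 * pi * real (2 * k))) = 1 / 4 * ?D2 k" for k
    unfolding central_moment_X_2 target2 m A1_def A2_def
    by (simp add: algebra_simps power2_eq_square add_divide_distrib diff_divide_distrib)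
  moreover have "(\<lambda>k. 1 / 4 * ?D2 k) \<in> O(\<lambda>k. real (2 * k) powr (-3/2))"
    by (intro landau_o.big.cmult_in_iff[THEN iffD2] landau_o.big_trans[OF D2]) (simp, real_asymp)
  ultimately show "(\<lambda>k. central_moment_X 2 (2 * k)
      - ((3/4 - 2/pi) * real (2 * k) - 3/4 + 3/pi - sqrt (2 / (pi * real (2 * k)))
           + 11 / (12 * pi * real (2 * k)))) \<in> O(\<lambda>k. real (2 * k) powr (-3/2))"
    by (simp only:)

  let ?P3 = "\<lambda>k. shape3 (s k) - 3 * shape2 (s k) - 3 * shape1 (s k) * (3 * s k ^ 2 - 2) + 6 * shape1 (s k)
      + 10 * s k ^ 3 - 43 / 2 * s k + 241 / 16 * (1 / s k)"
  let ?Q3 = "\<lambda>k. 6 * shape1 (s k) ^ 2 - 3 * shape1 (s k) * shape2 (s k) - 24"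
  let ?R3 = "\<lambda>k. 2 * shape1 (s k) ^ 3 - 16 * s k ^ 3 + 36 * s k - 5 / 2 * (1 / s k)"
  have PQR3: "?P3 \<in> O(\<lambda>k. real k powr (-1))" "?Q3 \<in> O(\<lambda>k. real k powr (-1))"
      "?R3 \<in> O(\<lambda>k. real k powr (-1))"
    unfolding s_def
    by (rule bigo_sqrt_double[OF shape_cancellation(3)] bigo_sqrt_double[OF shape_cancellation(4)]
          bigo_sqrt_double[OF shape_cancellation(5)]; real_asymp)+
  have target3: "sqrt (2/pi) *
          ((4/pi - 5/4) * real (2 * k) powr (3/2) + (43/16 - 9/pi) * real (2 * k) powr (1/2)
           - 3 * sqrt (2 * pi) / 4 + 3 * sqrt (2/pi)
           - (241/128 - 5 / (8 * pi)) * (1 / sqrt (real (2 * k))))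
      = c * ((2 * c ^ 2 - 5/4) * s k ^ 3 + (43/16 - 9 / 2 * c ^ 2) * s k)
        - 3 / 2 + 3 * c ^ 2 - c * (241/128 - 5 / 16 * c ^ 2) * (1 / s k)" for k
  proof -
    have "real (2 * k) powr (1/2) = s k"
      by (simp add: s_def powr_half_sqrt)
    moreover have "real (2 * k) powr (3/2) = s k ^ 3"
    proof -
      have "real (2 * k) powr (3/2) = real (2 * k) powr (1 + 1/2)" by simp
      also have "\<dots> = real (2 * k) * s k"
        unfolding powr_add by (simp add: s_def powr_half_sqrt)
      finally show ?thesis using s2[of k] by (simp add: power3_eq_cube power2_eq_square)
    qed
    moreover have "sqrt (real (2 * k)) = s k" by (simp add: s_def)
    moreover have "4 / pi = 2 * c ^ 2" "9 / pi = 9 / 2 * c ^ 2" "5 / (8 * pi) = 5 / 16 * c ^ 2"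
      using c_pos by (simp_all add: pi_eq)
    moreover have "c * sqrt (2 * pi) = 2"
      by (simp add: c_def flip: real_sqrt_mult)
    ultimately show ?thesis
      unfolding c_def[symmetric]
      by (simp only:) (simp add: algebra_simps power2_eq_square power3_eq_cube)
  qed
  let ?D3 = "\<lambda>k. E3 k - 3 * (A1 k * E2 k)
      + E1 k * (6 * (A1 k * A1 k) - 3 * A2 k + 6 * (A1 k * E1 k) + 2 * (E1 k * E1 k) - 3 * E2 k)
      + c * ?P3 k + c ^ 2 * ?Q3 k + c ^ 3 * ?R3 k"
  \<comment> \<open>The factor \<open>bracket\<close> of \<open>E1\<close> has order \<open>k\<close>, which costs the mean one full power of \<open>k\<close>.\<close>
  have E3: "E3 \<in> O(\<lambda>k. real k powr (-1))" 
    by (rule landau_o.big_trans[OF E(3)]) real_asymp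
  have E2': "E2 \<in> O(\<lambda>k. real k powr 1)"
    by (rule landau_o.big_trans[OF E(2)]) real_asymp
  have bracket: "(\<lambda>k. 6 * (A1 k * A1 k) - 3 * A2 k + 6 * (A1 k * E1 k) + 2 * (E1 k * E1 k) - 3 * E2 k)
      \<in> O(\<lambda>k. real k powr 1)"
    by (intro sum_in_bigo landau_o.big.cmult_in_iff[THEN iffD2] A2 E2'
        bigo_powr_mult[OF A1 A1] bigo_powr_mult[OF A1 E(1)] bigo_powr_mult[OF E(1) E(1)]) simp_all
  have D3: "?D3 \<in> O(\<lambda>k. real k powr (-1))"
    by (intro sum_in_bigo landau_o.big.cmult_in_iff[THEN iffD2] PQR3 E3
        bigo_powr_mult[OF A1 E(2)] bigo_powr_mult[OF E(1) bracket]) (use c_pos in simp_all)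
  have "central_moment_X 3 (2 * k)
      - sqrt (2/pi) *
          ((4/pi - 5/4) * real (2 * k) powr (3/2) + (43/16 - 9/pi) * real (2 * k) powr (1/2)
           - 3 * sqrt (2 * pi) / 4 + 3 * sqrt (2/pi)
           - (241/128 - 5 / (8 * pi)) * (1 / sqrt (real (2 * k)))) = 1 / 8 * ?D3 k" for k
    unfolding central_moment_X_3 target3 m A1_def A2_def
    by (simp add: algebra_simps power2_eq_square power3_eq_cube add_divide_distrib diff_divide_distrib)
  moreover have "(\<lambda>k. 1 / 8 * ?D3 k) \<in> O(\<lambda>k. 1 / real (2 * k))"
    by (intro landau_o.big.cmult_in_iff[THEN iffD2] landau_o.big_trans[OF D3]) (simp, real_asymp)
  ultimately show "(\<lambda>k. central_moment_X 3 (2 * k)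
      - sqrt (2/pi) *
          ((4/pi - 5/4) * real (2 * k) powr (3/2) + (43/16 - 9/pi) * real (2 * k) powr (1/2)
           - 3 * sqrt (2 * pi) / 4 + 3 * sqrt (2/pi)
           - (241/128 - 5 / (8 * pi)) * (1 / sqrt (real (2 * k))))) \<in> O(\<lambda>k. 1 / real (2 * k))"
    by (simp only:)
qed

end
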